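(* Suppose that the following assumptions hold. (1) (Balanced panel of groups) $N_{g,t}>0$ for all $(g,t)\in\{1,\dots,G\}\times\{1,\dots,T\}$. (2) (Sharp design) $D_{i,g,t}=D_{g,t}$ for all $(g,t)$ and all $i\in\{1,\dots,N_{g,t}\}$. (3) (Independent groups) The vectors $(Y_{g,t}(0),Y_{g,t}(1),D_{g,t})_{1\le t\le T}$, $g=1,\dots,G$, are mutually independent. (4) (Strong exogeneity) For all $g\in\{1,\dots,G\}$ and $t\in\{2,\dots,T\}$, $E(Y_{g,t}(0)-Y_{g,t-1}(0)\mid D_{g,1},\dots,D_{g,T})=E(Y_{g,t}(0)-Y_{g,t-1}(0))$. (5) (Common trends) For every $t\in\{2,\dots,T\}$, $E(Y_{g,t}(0)-Y_{g,t-1}(0))$ does not vary across $g$. Then $$\beta_{fe}=E\left[\sum_{(g,t):D_{g,t}=1}\frac{N_{g,t}}{N_1}\,w_{g,t}\,\Delta_{g,t}\right].$$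
   Context: Setting. There are $G$ groups and $T$ periods; $N_{g,t}$ is the (non-random) number of observations in cell $(g,t)\in\{1,\dots,G\}\times\{1,\dots,T\}$. Observation $i\in\{1,\dots,N_{g,t}\}$ of cell $(g,t)$ has a binary treatment $D_{i,g,t}\in\{0,1\}$, potential outcomes $Y_{i,g,t}(0),Y_{i,g,t}(1)$ and observed outcome $Y_{i,g,t}=Y_{i,g,t}(D_{i,g,t})$. Treatments and potential outcomes are random variables, and potential outcomes have finite expectations. Cell averages: $D_{g,t}=\frac1{N_{g,t}}\sum_i D_{i,g,t}$, $Y_{g,t}(d)=\frac1{N_{g,t}}\sum_i Y_{i,g,t}(d)$ for $d\in\{0,1\}$, $Y_{g,t}=\frac1{N_{g,t}}\sum_i Y_{i,g,t}$. The average treatment effect in cell $(g,t)$ is $\Delta_{g,t}=\frac1{N_{g,t}}\sum_{i=1}^{N_{g,t}}[Y_{i,g,t}(1)-Y_{i,g,t}(0)]$. $N_1=\sum_{i,g,t}D_{i,g,t}$ is the number of treated observations. Regression. $\widehat\beta_{fe}$ is the coefficient of $D_{g,t}$ in the OLS regression, at the observation level, of $Y_{i,g,t}$ on group fixed effects, period fixed effects and $D_{g,t}$ (equivalently, the cell-level regression of $Y_{g,t}$ on group and period fixed effects and $D_{g,t}$, weighted by $N_{g,t}$). $\beta_{fe}=E[\widehat\beta_{fe}]$. Standing assumption: (almost surely) $D_{g,t}$ is not collinear with the group and period fixed effects, so that $\widehat\beta_{fe}$ is well defined. Weights. $\varepsilon_{g,t}$ is the residual of cell $(g,t)$ in the observation-level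 OLS regression (i.e. cell-level regression weighted by $N_{g,t}$) of $D_{g,t}$ on group and period fixed effects, $D_{g,t}=\alpha+\gamma_g+\lambda_t+\varepsilon_{g,t}$, and $$w_{g,t}=\frac{\varepsilon_{g,t}}{\sum_{(g',t'):D_{g',t'}=1}\frac{N_{g',t'}}{N_1}\varepsilon_{g',t'}},$$ the denominator being nonzero under the non-collinearity assumption. *)

theory Defs
  imports "HOL-Probability.Probability"
begin

text \<open>
  Conventions: groups are \<open>g \<in> {1..G}\<close>, periods \<open>t \<in> {1..T}\<close>, and the observations of cell
  \<open>(g, t)\<close> are \<open>i \<in> {1..N g t}\<close>. Arguments come in the order \<open>i g t\<close>, followed by the
  treatment value \<open>d\<close> for potential outcomes, followed by the sample point.
\<close>

definition cell_mean ::
  "(nat \<Rightarrow> nat \<Rightarrow> nat) \<Rightarrow> (nat \<Rightarrow> nat \<Rightarrow> nat \<Rightarrow> 'a \<Rightarrow> real) \<Rightarrow> nat \<Rightarrow> nat \<Rightarrow> 'a \<Rightarrow> real" where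
  "cell_mean N X g t \<omega> = (\<Sum>i = 1..N g t. X i g t \<omega>) / real (N g t)"

definition observed ::
  "(nat \<Rightarrow> nat \<Rightarrow> nat \<Rightarrow> 'a \<Rightarrow> nat) \<Rightarrow> (nat \<Rightarrow> nat \<Rightarrow> nat \<Rightarrow> nat \<Rightarrow> 'a \<Rightarrow> real)
    \<Rightarrow> nat \<Rightarrow> nat \<Rightarrow> nat \<Rightarrow> 'a \<Rightarrow> real" where
  "observed D Y i g t \<omega> = Y i g t (D i g t \<omega>) \<omega>"

definition cell_treatment ::
  "(nat \<Rightarrow> nat \<Rightarrow> nat) \<Rightarrow> (nat \<Rightarrow> nat \<Rightarrow> nat \<Rightarrow> 'a \<Rightarrow> nat) \<Rightarrow> nat \<Rightarrow> nat \<Rightarrow> 'a \<Rightarrow> real" where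
  "cell_treatment N D = cell_mean N (\<lambda>i g t \<omega>. real (D i g t \<omega>))"

definition cell_potential ::
  "(nat \<Rightarrow> nat \<Rightarrow> nat) \<Rightarrow> (nat \<Rightarrow> nat \<Rightarrow> nat \<Rightarrow> nat \<Rightarrow> 'a \<Rightarrow> real)
    \<Rightarrow> nat \<Rightarrow> nat \<Rightarrow> nat \<Rightarrow> 'a \<Rightarrow> real" where
  "cell_potential N Y d = cell_mean N (\<lambda>i g t. Y i g t d)"

definition cell_effect ::
  "(nat \<Rightarrow> nat \<Rightarrow> nat) \<Rightarrow> (nat \<Rightarrow> nat \<Rightarrow> nat \<Rightarrow> nat \<Rightarrow> 'a \<Rightarrow> real) \<Rightarrow> nat \<Rightarrow> nat \<Rightarrow> 'a \<Rightarrow> real" where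
  "cell_effect N Y = cell_mean N (\<lambda>i g t \<omega>. Y i g t 1 \<omega> - Y i g t 0 \<omega>)"

definition num_treated ::
  "nat \<Rightarrow> nat \<Rightarrow> (nat \<Rightarrow> nat \<Rightarrow> nat) \<Rightarrow> (nat \<Rightarrow> nat \<Rightarrow> nat \<Rightarrow> 'a \<Rightarrow> nat) \<Rightarrow> 'a \<Rightarrow> nat" where
  "num_treated G T N D \<omega> = (\<Sum>g = 1..G. \<Sum>t = 1..T. \<Sum>i = 1..N g t. D i g t \<omega>)"

definition treated_cells ::
  "nat \<Rightarrow> nat \<Rightarrow> (nat \<Rightarrow> nat \<Rightarrow> nat) \<Rightarrow> (nat \<Rightarrow> nat \<Rightarrow> nat \<Rightarrow> 'a \<Rightarrow> nat) \<Rightarrow> 'a \<Rightarrow> (nat \<times> nat) set" where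
  "treated_cells G T N D \<omega> = {(g, t) \<in> {1..G} \<times> {1..T}. cell_treatment N D g t \<omega> = 1}"

text \<open>
  Ordinary least squares with group and period fixed effects, at the observation level.
  No normalisation of \<open>(a, c, l)\<close> is imposed: the intercept and the fixed effects are not
  identified separately, but the coefficient \<open>fe_coef\<close> (absent collinearity) and the residuals
  \<open>fe_residual\<close> (when every cell is nonempty) do not depend on the chosen minimiser.
  If \<open>x\<close> is collinear with the fixed effects, every \<open>b\<close> is part of a minimiser, so \<open>fe_coef\<close> is then
  the junk value \<open>THE b. True\<close>, which does not depend on \<open>y\<close> or \<open>x\<close>.
\<close>

definition fe_ssr ::
  "nat \<Rightarrow> nat \<Rightarrow> (nat \<Rightarrow> nat \<Rightarrow> nat) \<Rightarrow> (nat \<Rightarrow> nat \<Rightarrow> nat \<Rightarrow> real)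
    \<Rightarrow> real \<Rightarrow> (nat \<Rightarrow> real) \<Rightarrow> (nat \<Rightarrow> real) \<Rightarrow> real" where
  "fe_ssr G T N y a c l =
     (\<Sum>g = 1..G. \<Sum>t = 1..T. \<Sum>i = 1..N g t. (y i g t - (a + c g + l t))\<^sup>2)"

definition fe_residual ::
  "nat \<Rightarrow> nat \<Rightarrow> (nat \<Rightarrow> nat \<Rightarrow> nat) \<Rightarrow> (nat \<Rightarrow> nat \<Rightarrow> real) \<Rightarrow> nat \<Rightarrow> nat \<Rightarrow> real" where
  "fe_residual G T N x g t =
     (THE e. \<exists>a c l.
        (\<forall>a' c' l'. fe_ssr G T N (\<lambda>i. x) a c l \<le> fe_ssr G T N (\<lambda>i. x) a' c' l') \<and>
        e = x g t - (a + c g + l t))"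

definition fe_coef ::
  "nat \<Rightarrow> nat \<Rightarrow> (nat \<Rightarrow> nat \<Rightarrow> nat) \<Rightarrow> (nat \<Rightarrow> nat \<Rightarrow> nat \<Rightarrow> real)
    \<Rightarrow> (nat \<Rightarrow> nat \<Rightarrow> real) \<Rightarrow> real" where
  "fe_coef G T N y x =
     (THE b. \<exists>a c l. \<forall>b' a' c' l'.
        fe_ssr G T N (\<lambda>i g t. y i g t - b * x g t) a c l
          \<le> fe_ssr G T N (\<lambda>i g t. y i g t - b' * x g t) a' c' l')"

definition fe_collinear :: "nat \<Rightarrow> nat \<Rightarrow> (nat \<Rightarrow> nat \<Rightarrow> real) \<Rightarrow> bool" where
  "fe_collinear G T x \<longleftrightarrow>
     (\<exists>a c l. \<forall>g\<in>{1..G}. \<forall>t\<in>{1..T}. x g t = a + c g + l t)"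

definition beta_fe_hat ::
  "nat \<Rightarrow> nat \<Rightarrow> (nat \<Rightarrow> nat \<Rightarrow> nat) \<Rightarrow> (nat \<Rightarrow> nat \<Rightarrow> nat \<Rightarrow> 'a \<Rightarrow> nat)
    \<Rightarrow> (nat \<Rightarrow> nat \<Rightarrow> nat \<Rightarrow> nat \<Rightarrow> 'a \<Rightarrow> real) \<Rightarrow> 'a \<Rightarrow> real" where
  "beta_fe_hat G T N D Y \<omega> =
     fe_coef G T N (\<lambda>i g t. observed D Y i g t \<omega>) (\<lambda>g t. cell_treatment N D g t \<omega>)"

definition beta_fe ::
  "'a measure \<Rightarrow> nat \<Rightarrow> nat \<Rightarrow> (nat \<Rightarrow> nat \<Rightarrow> nat) \<Rightarrow> (nat \<Rightarrow> nat \<Rightarrow> nat \<Rightarrow> 'a \<Rightarrow> nat)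
    \<Rightarrow> (nat \<Rightarrow> nat \<Rightarrow> nat \<Rightarrow> nat \<Rightarrow> 'a \<Rightarrow> real) \<Rightarrow> real" where
  "beta_fe M G T N D Y = (\<integral>\<omega>. beta_fe_hat G T N D Y \<omega> \<partial>M)"

definition treatment_residual ::
  "nat \<Rightarrow> nat \<Rightarrow> (nat \<Rightarrow> nat \<Rightarrow> nat) \<Rightarrow> (nat \<Rightarrow> nat \<Rightarrow> nat \<Rightarrow> 'a \<Rightarrow> nat)
    \<Rightarrow> nat \<Rightarrow> nat \<Rightarrow> 'a \<Rightarrow> real" where
  "treatment_residual G T N D g t \<omega> =
     fe_residual G T N (\<lambda>g t. cell_treatment N D g t \<omega>) g t"

definition fe_weight ::
  "nat \<Rightarrow> nat \<Rightarrow> (nat \<Rightarrow> nat \<Rightarrow> nat) \<Rightarrow> (nat \<Rightarrow> nat \<Rightarrow> nat \<Rightarrow> 'a \<Rightarrow> nat)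
    \<Rightarrow> nat \<Rightarrow> nat \<Rightarrow> 'a \<Rightarrow> real" where
  "fe_weight G T N D g t \<omega> =
     treatment_residual G T N D g t \<omega> /
     (\<Sum>(g', t')\<in>treated_cells G T N D \<omega>.
        real (N g' t') / real (num_treated G T N D \<omega>) * treatment_residual G T N D g' t' \<omega>)"

definition group_treatment_algebra ::
  "'a measure \<Rightarrow> nat \<Rightarrow> (nat \<Rightarrow> nat \<Rightarrow> nat) \<Rightarrow> (nat \<Rightarrow> nat \<Rightarrow> nat \<Rightarrow> 'a \<Rightarrow> nat)
    \<Rightarrow> nat \<Rightarrow> 'a measure" where
  "group_treatment_algebra M T N D g =
     vimage_algebra (space M) (\<lambda>\<omega>. \<lambda>t\<in>{1..T}. cell_treatment N D g t \<omega>)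
       (\<Pi>\<^sub>M t\<in>{1..T}. borel)"

end

theory Submission
  imports Defs
begin

text \<open>
  By Frisch--Waugh, \<open>beta_fe_hat\<close> is a linear combination of the cell means of the outcome, with
  coefficients proportional to \<open>N g t\<close> times the residual of cell \<open>(g, t)\<close>. Under the sharp design
  a cell mean is \<open>Y\<^sub>g\<^sub>t(0) + D\<^sub>g\<^sub>t \<Delta>\<^sub>g\<^sub>t\<close>; the \<open>\<Delta>\<close>-part is the claimed weighted sum of effects. The
  coefficients sum to zero within each group and within each period, so in the \<open>Y(0)\<close>-part one may
  replace \<open>Y\<^sub>g\<^sub>t(0)\<close> by \<open>u\<^sub>g\<^sub>t = Y\<^sub>g\<^sub>t(0) - Y\<^sub>g\<^sub>1(0) - \<psi>\<^sub>t\<close>, where \<open>\<psi>\<^sub>t\<close> is the common mean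
  evolution from period 1 to \<open>t\<close>. Strong exogeneity makes \<open>u\<^sub>g\<^sub>t\<close> orthogonal to every event in the
  treatments of group \<open>g\<close>, and independence across groups extends this to every event in the
  treatments of all groups. The coefficients are functions of the treatments, which take finitely
  many values, so the \<open>Y(0)\<close>-part has expectation zero.
\<close>

section \<open>Least squares with group and period fixed effects\<close>

lemma least_squares_projection_exists:
  fixes x :: "'i \<Rightarrow> real" and v :: "'j \<Rightarrow> 'i \<Rightarrow> real"
  assumes "finite J" and I: "finite I"
  shows "\<exists>b. \<forall>k\<in>J. (\<Sum>i\<in>I. (x i - (\<Sum>j\<in>J. b j * v j i)) * v k i) = 0"
  using assms(1)
proof (induction J arbitrary: x rule: finite_induct) \<comment> \<open>Gram--Schmidt\<close>
  case empty
  then show ?case by simp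
next
  case (insert m J)
  obtain b where b: "\<And>k. k \<in> J \<Longrightarrow> (\<Sum>i\<in>I. (x i - (\<Sum>j\<in>J. b j * v j i)) * v k i) = 0"
    using insert.IH[of x] by blast
  obtain q where q: "\<And>k. k \<in> J \<Longrightarrow> (\<Sum>i\<in>I. (v m i - (\<Sum>j\<in>J. q j * v j i)) * v k i) = 0"
    using insert.IH[of "v m"] by blast
  define e where "e = (\<lambda>i. x i - (\<Sum>j\<in>J. b j * v j i))"
  define r where "r = (\<lambda>i. v m i - (\<Sum>j\<in>J. q j * v j i))"
  have e: "(\<Sum>i\<in>I. e i * v k i) = 0" and r: "(\<Sum>i\<in>I. r i * v k i) = 0" if "k \<in> J" for k
    using b[OF that] q[OF that] by (auto simp: e_def r_def)
  \<comment> \<open>if \<open>v m\<close> depends on the other regressors then \<open>r\<close> vanishes on \<open>I\<close>, and \<open>s = 0\<close> since \<open>x / 0 = 0\<close>\<close>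
  define s where "s = (\<Sum>i\<in>I. e i * r i) / (\<Sum>i\<in>I. r i * r i)"
  define e' where "e' = (\<lambda>i. e i - s * r i)"
  have e'J: "(\<Sum>i\<in>I. e' i * v k i) = 0" if "k \<in> J" for k
    using e[OF that] r[OF that]
    by (simp add: e'_def left_diff_distrib sum_subtractf mult.assoc sum_distrib_left[symmetric])
  have e'r: "(\<Sum>i\<in>I. e' i * r i) = 0"
  proof (cases "(\<Sum>i\<in>I. r i * r i) = 0")
    case True
    then have "\<forall>i\<in>I. r i = 0"
      using I by (subst (asm) sum_nonneg_eq_0_iff) auto
    then show ?thesis by simp
  next
    case False
    moreover have "(\<Sum>i\<in>I. e' i * r i) = (\<Sum>i\<in>I. e i * r i) - s * (\<Sum>i\<in>I. r i * r i)"
      by (simp add: e'_def left_diff_distrib sum_subtractf mult.assoc sum_distrib_left)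
    ultimately show ?thesis
      by (simp add: s_def)
  qed
  \<comment> \<open>\<open>v m\<close> is \<open>r\<close> plus a combination of the
    \<open>v j\<close> with \<open>j\<close> in \<open>J\<close>. Since \<open>e'\<close> is
    orthogonal to \<open>r\<close> and to each \<open>v j\<close>, it is orthogonal to
    \<open>v m\<close>.\<close>
  have "(\<Sum>i\<in>I. e' i * (\<Sum>j\<in>J. q j * v j i)) = (\<Sum>j\<in>J. q j * (\<Sum>i\<in>I. e' i * v j i))"
    unfolding sum_distrib_left by (subst sum.swap) (simp add: mult_ac)
  also have "\<dots> = 0"
    using e'J by simp
  finally have e'm: "(\<Sum>i\<in>I. e' i * v m i) = 0"
    using e'r by (simp add: r_def right_diff_distrib sum_subtractf)
  \<comment> \<open>Read off from \<open>e' = e - s * r\<close> by expanding \<open>e\<close> and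
    \<open>r\<close> in the regressors.\<close>
  define b' where "b' = (\<lambda>j. if j = m then s else b j - s * q j)"
  have "(\<Sum>j\<in>J. b' j * v j i) = (\<Sum>j\<in>J. (b j - s * q j) * v j i)" for i
    using insert.hyps by (intro sum.cong) (auto simp: b'_def)
  then have "x i - (\<Sum>j\<in>insert m J. b' j * v j i) = e' i" for i
    using insert.hyps
    by (simp add: b'_def e'_def e_def r_def algebra_simps sum_subtractf sum_distrib_left)
  then show ?case
    using e'J e'm by (intro exI[of _ b']) auto
qed

text \<open>The regressors are one dummy per group and one per period, indexed by a disjoint sum,
  over the set of all observations. Constants lie in the span of the group dummies, so the intercept
  can be 0 and a test intercept \<open>a'\<close> joins the group coefficients. The dummies may be
  linearly dependent, which the projection lemma permits.\<close>

lemma fe_projection_exists: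
  fixes y :: "nat \<Rightarrow> nat \<Rightarrow> nat \<Rightarrow> real"
  obtains a c l where "\<And>a' c' l'.
    (\<Sum>g=1..G. \<Sum>t=1..T. \<Sum>i=1..N g t. (y i g t - (a + c g + l t)) * (a' + c' g + l' t)) = 0"
proof -
  define I where "I = (SIGMA g:{1..G}. SIGMA t:{1..T}. {1..N g t})"
  define J where "J = {1..G} <+> {1..T}"
  define v :: "nat + nat \<Rightarrow> nat \<times> nat \<times> nat \<Rightarrow> real" where
    "v = (\<lambda>j (g, t, i). case j of Inl g' \<Rightarrow> of_bool (g' = g) | Inr t' \<Rightarrow> of_bool (t' = t))"
  have fin: "finite I" "finite J"
    by (auto simp: I_def J_def)
  have I_sum: "(\<Sum>g=1..G. \<Sum>t=1..T. \<Sum>i=1..N g t. f g t i) = (\<Sum>(g,t,i)\<in>I. f g t i)"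
    for f :: "nat \<Rightarrow> nat \<Rightarrow> nat \<Rightarrow> real"
    by (simp add: I_def sum.Sigma)
  have J_sum: "(\<Sum>j\<in>J. b j * v j (g, t, i)) = b (Inl g) + b (Inr t)"
    if "(g, t, i) \<in> I" for b g t i
    using that by (simp add: J_def I_def v_def sum.Plus of_bool_def if_distrib sum.delta cong: if_cong)
  obtain b where b: "\<And>k. k \<in> J \<Longrightarrow>
      (\<Sum>p\<in>I. ((\<lambda>(g,t,i). y i g t) p - (\<Sum>j\<in>J. b j * v j p)) * v k p) = 0"
    using least_squares_projection_exists[OF fin(2,1), of "\<lambda>(g,t,i). y i g t" v] by blast
  have "(\<Sum>g=1..G. \<Sum>t=1..T. \<Sum>i=1..N g t.
      (y i g t - (0 + b (Inl g) + b (Inr t))) * (a' + c' g + l' t)) = 0" for a' c' l'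
  proof -
    define d where "d = (\<lambda>j. case j of Inl g \<Rightarrow> a' + c' g | Inr t \<Rightarrow> l' t)"
    have "(\<Sum>g=1..G. \<Sum>t=1..T. \<Sum>i=1..N g t.
        (y i g t - (0 + b (Inl g) + b (Inr t))) * (a' + c' g + l' t)) =
      (\<Sum>p\<in>I. ((\<lambda>(g,t,i). y i g t) p - (\<Sum>j\<in>J. b j * v j p)) * (\<Sum>k\<in>J. d k * v k p))"
      unfolding I_sum by (intro sum.cong) (auto simp: J_sum d_def)
    also have "\<dots> =
      (\<Sum>k\<in>J. d k * (\<Sum>p\<in>I. ((\<lambda>(g,t,i). y i g t) p - (\<Sum>j\<in>J. b j * v j p)) * v k p))"
      unfolding sum_distrib_left by (subst sum.swap) (simp add: mult_ac)
    also have "\<dots> = 0"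
      using b by simp
    finally show ?thesis .
  qed
  then show thesis by (rule that)
qed

section \<open>Minimisers of the sum of squares via orthogonality\<close>

text \<open>Expand the square: orthogonality kills the cross term, and \<open>d\<close> is constant
  within cells, whence the factor \<open>N g t\<close>. Two outcome arrays are allowed so that
  \<open>d\<close> can also contain a change of the slope on a regressor.\<close>

lemma fe_ssr_pythagoras:
  assumes orth: "(\<Sum>g=1..G. \<Sum>t=1..T. \<Sum>i=1..N g t. (y i g t - (a + c g + l t)) * d g t) = 0"
    and d: "\<And>g t i. y' i g t - (a' + c' g + l' t) = y i g t - (a + c g + l t) + d g t"
  shows "fe_ssr G T N y' a' c' l' =
    fe_ssr G T N y a c l + (\<Sum>g=1..G. \<Sum>t=1..T. real (N g t) * (d g t)\<^sup>2)"
proof -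
  have "fe_ssr G T N y' a' c' l' = (\<Sum>g=1..G. \<Sum>t=1..T. \<Sum>i=1..N g t.
      (y i g t - (a + c g + l t))\<^sup>2 + 2 * ((y i g t - (a + c g + l t)) * d g t) + (d g t)\<^sup>2)"
    unfolding fe_ssr_def d by (intro sum.cong refl) (simp add: power2_eq_square algebra_simps)
  also have "\<dots> = fe_ssr G T N y a c l
      + 2 * (\<Sum>g=1..G. \<Sum>t=1..T. \<Sum>i=1..N g t. (y i g t - (a + c g + l t)) * d g t)
      + (\<Sum>g=1..G. \<Sum>t=1..T. real (N g t) * (d g t)\<^sup>2)"
    unfolding fe_ssr_def sum.distrib sum_distrib_left[symmetric] by simp
  finally show ?thesis using orth by simp
qed

text \<open>With every cell nonempty the weighted norm is definite on the cells. Uniqueness of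
  residuals and of the slope rests on this.\<close>

lemma cell_norm_eq_0D:
  fixes d :: "nat \<Rightarrow> nat \<Rightarrow> real"
  assumes N: "\<forall>g\<in>{1..G}. \<forall>t\<in>{1..T}. N g t > 0"
    and le: "(\<Sum>g=1..G. \<Sum>t=1..T. real (N g t) * (d g t)\<^sup>2) \<le> 0"
    and gt: "g \<in> {1..G}" "t \<in> {1..T}"
  shows "d g t = 0"
proof -
  have "(\<Sum>p\<in>{1..G}\<times>{1..T}. real (N (fst p) (snd p)) * (d (fst p) (snd p))\<^sup>2) \<le> 0"
    using le by (simp add: sum.cartesian_product case_prod_beta)
  moreover have "real (N g t) * (d g t)\<^sup>2 \<le>
      (\<Sum>p\<in>{1..G}\<times>{1..T}. real (N (fst p) (snd p)) * (d (fst p) (snd p))\<^sup>2)"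
    using gt member_le_sum[of "(g, t)" "{1..G}\<times>{1..T}"
        "\<lambda>p. real (N (fst p) (snd p)) * (d (fst p) (snd p))\<^sup>2"] by simp
  ultimately have "real (N g t) * (d g t)\<^sup>2 \<le> 0" by simp
  moreover have "real (N g t) > 0" using N gt by auto
  ultimately show ?thesis
    by (simp add: mult_le_0_iff)
qed

text \<open>By Pythagoras, orthogonality makes \<open>(a, c, l)\<close> a minimiser. Any other
  minimiser differs from it by an array of norm zero, so it has the same residuals even if its
  coefficients differ.\<close>

lemma fe_residual_eqI:
  assumes N: "\<forall>g\<in>{1..G}. \<forall>t\<in>{1..T}. N g t > 0"
    and orth: "\<And>a' c' l'.
      (\<Sum>g=1..G. \<Sum>t=1..T. \<Sum>i=1..N g t. (x g t - (a + c g + l t)) * (a' + c' g + l' t)) = 0"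
    and gt: "g \<in> {1..G}" "t \<in> {1..T}"
  shows "fe_residual G T N x g t = x g t - (a + c g + l t)"
proof -
  have pyth: "fe_ssr G T N (\<lambda>i. x) a' c' l' = fe_ssr G T N (\<lambda>i. x) a c l +
      (\<Sum>g=1..G. \<Sum>t=1..T. real (N g t) * ((a - a') + (c g - c' g) + (l t - l' t))\<^sup>2)" for a' c' l'
    by (rule fe_ssr_pythagoras)
      (use orth[of "a - a'" "\<lambda>g. c g - c' g" "\<lambda>t. l t - l' t"] in \<open>simp_all add: algebra_simps\<close>)
  show ?thesis
    unfolding fe_residual_def
  proof (rule the_equality)
    have "fe_ssr G T N (\<lambda>i. x) a c l \<le> fe_ssr G T N (\<lambda>i. x) a' c' l'" for a' c' l'
      unfolding pyth[of a' c' l'] by (auto intro!: sum_nonneg)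
    then show "\<exists>a' c' l'.
        (\<forall>a'' c'' l''. fe_ssr G T N (\<lambda>i. x) a' c' l' \<le> fe_ssr G T N (\<lambda>i. x) a'' c'' l'') \<and>
        x g t - (a + c g + l t) = x g t - (a' + c' g + l' t)"
      by blast
  next
    fix e assume "\<exists>a' c' l'.
        (\<forall>a'' c'' l''. fe_ssr G T N (\<lambda>i. x) a' c' l' \<le> fe_ssr G T N (\<lambda>i. x) a'' c'' l'') \<and>
        e = x g t - (a' + c' g + l' t)"
    then obtain a' c' l' where min: "fe_ssr G T N (\<lambda>i. x) a' c' l' \<le> fe_ssr G T N (\<lambda>i. x) a c l"
      and e: "e = x g t - (a' + c' g + l' t)" by blast
    have "(a - a') + (c g - c' g) + (l t - l' t) = 0"
      using min pyth[of a' c' l']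
      by (intro cell_norm_eq_0D[OF N _ gt, of "\<lambda>g t. (a - a') + (c g - c' g) + (l t - l' t)"]) simp
    then show "e = x g t - (a + c g + l t)"
      using e by simp
  qed
qed

text \<open>The cell-level normal equations. Later arguments use these in place of the definite
  description; the factor \<open>N g t\<close> counts the equal summands within a cell.\<close>

lemma fe_residual_projection:
  assumes N: "\<forall>g\<in>{1..G}. \<forall>t\<in>{1..T}. N g t > 0"
  obtains a c l where
    "\<And>g t. g \<in> {1..G} \<Longrightarrow> t \<in> {1..T} \<Longrightarrow> x g t = fe_residual G T N x g t + (a + c g + l t)"
    "\<And>a' c' l'.
      (\<Sum>g=1..G. \<Sum>t=1..T. real (N g t) * fe_residual G T N x g t * (a' + c' g + l' t)) = 0"
proof -
  obtain a c l where orth: "\<And>a' c' l'. (\<Sum>g=1..G. \<Sum>t=1..T. \<Sum>i=1..N g t.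
      (x g t - (a + c g + l t)) * (a' + c' g + l' t)) = 0"
    by (rule fe_projection_exists[where G=G and T=T and N=N and y="\<lambda>i. x"]) blast
  have res: "fe_residual G T N x g t = x g t - (a + c g + l t)"
    if "g \<in> {1..G}" "t \<in> {1..T}" for g t
    by (rule fe_residual_eqI[where a = a and c = c and l = l, OF N orth that])
  have "(\<Sum>g=1..G. \<Sum>t=1..T. real (N g t) * fe_residual G T N x g t * (a' + c' g + l' t)) =
      (\<Sum>g=1..G. \<Sum>t=1..T. \<Sum>i=1..N g t. (x g t - (a + c g + l t)) * (a' + c' g + l' t))"
    for a' c' l'
    by (intro sum.cong refl) (simp add: res mult.assoc)
  then show thesis
    using res orth by (intro that[of a c l]) auto
qed

text \<open>The normal equations tested against the dummy of group \<open>g\<close>; the next lemma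
  uses a period dummy.\<close>

lemma fe_residual_sum_periods:
  assumes N: "\<forall>g\<in>{1..G}. \<forall>t\<in>{1..T}. N g t > 0" and g: "g \<in> {1..G}"
  shows "(\<Sum>t=1..T. real (N g t) * fe_residual G T N x g t) = 0"
proof -
  have "(\<Sum>g'=1..G. \<Sum>t=1..T.
      real (N g' t) * fe_residual G T N x g' t * (0 + (if g' = g then 1 else 0) + 0)) = 0"
    by (rule fe_residual_projection[OF N, where x = x])
  also have "(\<Sum>g'=1..G. \<Sum>t=1..T.
      real (N g' t) * fe_residual G T N x g' t * (0 + (if g' = g then 1 else 0) + 0)) =
      (\<Sum>g'=1..G. if g' = g then \<Sum>t=1..T. real (N g' t) * fe_residual G T N x g' t else 0)"
    by (intro sum.cong refl) simp
  finally show ?thesis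
    using g by simp
qed

lemma fe_residual_sum_groups:
  assumes N: "\<forall>g\<in>{1..G}. \<forall>t\<in>{1..T}. N g t > 0" and t: "t \<in> {1..T}"
  shows "(\<Sum>g=1..G. real (N g t) * fe_residual G T N x g t) = 0"
proof -
  have "(\<Sum>g=1..G. \<Sum>t'=1..T.
      real (N g t') * fe_residual G T N x g t' * (0 + 0 + (if t' = t then 1 else 0))) = 0"
    by (rule fe_residual_projection[OF N, where x = x])
  then show ?thesis
    using t by (simp add: if_distrib[of "\<lambda>z. _ * z"] cong: if_cong)
qed

lemma fe_collinearI:
  assumes "\<And>g t. g \<in> {1..G} \<Longrightarrow> t \<in> {1..T} \<Longrightarrow> x g t = a + c g + l t"
  shows "fe_collinear G T x"
  using assms unfolding fe_collinear_def by blast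

text \<open>The fixed effects part of \<open>x\<close> is orthogonal to the residual, so the sum is
  the squared norm of the residual. If that were zero, \<open>x\<close> would equal its fixed
  effects part.\<close>

lemma fe_residual_inner_treatment_pos:
  assumes N: "\<forall>g\<in>{1..G}. \<forall>t\<in>{1..T}. N g t > 0" and "\<not> fe_collinear G T x"
  shows "(\<Sum>g=1..G. \<Sum>t=1..T. real (N g t) * fe_residual G T N x g t * x g t) > 0"
proof -
  let ?e = "fe_residual G T N x"
  obtain a c l where x: "\<And>g t. g \<in> {1..G} \<Longrightarrow> t \<in> {1..T} \<Longrightarrow> x g t = ?e g t + (a + c g + l t)"
    and orth: "(\<Sum>g=1..G. \<Sum>t=1..T. real (N g t) * ?e g t * (a + c g + l t)) = 0"
    by (rule fe_residual_projection[OF N, where x = x]) blast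
  have "(\<Sum>g=1..G. \<Sum>t=1..T. real (N g t) * ?e g t * x g t) =
      (\<Sum>g=1..G. \<Sum>t=1..T. real (N g t) * (?e g t)\<^sup>2 + real (N g t) * ?e g t * (a + c g + l t))"
    by (intro sum.cong refl, subst x) (auto simp: algebra_simps power2_eq_square)
  also have "\<dots> = (\<Sum>g=1..G. \<Sum>t=1..T. real (N g t) * (?e g t)\<^sup>2)"
    using orth by (simp add: sum.distrib)
  finally have eq: "(\<Sum>g=1..G. \<Sum>t=1..T. real (N g t) * ?e g t * x g t) = \<dots>" .
  show ?thesis
  proof (rule ccontr)
    assume "\<not> ?thesis"
    then have "(\<Sum>g=1..G. \<Sum>t=1..T. real (N g t) * (?e g t)\<^sup>2) \<le> 0"
      unfolding eq by simp
    then have "?e g t = 0" if "g \<in> {1..G}" "t \<in> {1..T}" for g t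
      by (rule cell_norm_eq_0D[OF N _ that])
    then have "\<forall>g\<in>{1..G}. \<forall>t\<in>{1..T}. x g t = a + c g + l t"
      using x by simp
    then show False
      using assms(2) unfolding fe_collinear_def by blast
  qed
qed

text \<open>Frisch--Waugh. With \<open>b0\<close> the claimed ratio, project
  \<open>y - b0 * x\<close> on the fixed effects. The remainder \<open>u\<close> is orthogonal to
  these by construction and to the residual of \<open>x\<close> by the choice of \<open>b0\<close>,
  so Pythagoras shows that \<open>b0\<close> minimises. A minimiser with another slope would make
  \<open>x\<close> collinear.\<close>

lemma fe_coef_eq:
  assumes N: "\<forall>g\<in>{1..G}. \<forall>t\<in>{1..T}. N g t > 0" and nc: "\<not> fe_collinear G T x"
  shows "fe_coef G T N y x =
    (\<Sum>g=1..G. \<Sum>t=1..T. fe_residual G T N x g t * (\<Sum>i=1..N g t. y i g t)) /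
    (\<Sum>g=1..G. \<Sum>t=1..T. real (N g t) * fe_residual G T N x g t * x g t)" (is "_ = ?num / ?den")
proof -
  let ?e = "fe_residual G T N x"
  define b0 where "b0 = ?num / ?den"
  have b0: "b0 * ?den = ?num"
    using fe_residual_inner_treatment_pos[OF N nc] by (simp add: b0_def)
  obtain a c l where fe: "\<And>a' c' l'. (\<Sum>g=1..G. \<Sum>t=1..T. \<Sum>i=1..N g t.
      (y i g t - b0 * x g t - (a + c g + l t)) * (a' + c' g + l' t)) = 0"
    by (rule fe_projection_exists[where G=G and T=T and N=N and y="\<lambda>i g t. y i g t - b0 * x g t"]) blast
  define u where "u = (\<lambda>i g t. y i g t - b0 * x g t - (a + c g + l t))"
  obtain ax cx lx
    where x: "\<And>g t. g \<in> {1..G} \<Longrightarrow> t \<in> {1..T} \<Longrightarrow> x g t = ?e g t + (ax + cx g + lx t)"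
    and orth: "(\<Sum>g=1..G. \<Sum>t=1..T. real (N g t) * ?e g t * (a + c g + l t)) = 0"
    by (rule fe_residual_projection[OF N, where x = x]) blast
  have "(\<Sum>g=1..G. \<Sum>t=1..T. \<Sum>i=1..N g t. u i g t * ?e g t) =
      (\<Sum>g=1..G. \<Sum>t=1..T. ?e g t * (\<Sum>i=1..N g t. y i g t) - b0 * (real (N g t) * ?e g t * x g t)
        - real (N g t) * ?e g t * (a + c g + l t))"
    by (intro sum.cong refl)
      (simp add: u_def sum_subtractf sum_distrib_right[symmetric] algebra_simps)
  also have "\<dots> = ?num - b0 * ?den"
    unfolding sum_subtractf orth by (simp add: sum_distrib_left)
  finally have ue: "(\<Sum>g=1..G. \<Sum>t=1..T. \<Sum>i=1..N g t. u i g t * ?e g t) = 0"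
    using b0 by simp
  \<comment> \<open>\<open>x\<close> is its residual plus fixed effects, and \<open>u\<close> is
    orthogonal to both.\<close>
  have ux: "(\<Sum>g=1..G. \<Sum>t=1..T. \<Sum>i=1..N g t. u i g t * (s * x g t + (a' + c' g + l' t))) = 0"
    for s a' c' l'
  proof -
    have "(\<Sum>g=1..G. \<Sum>t=1..T. \<Sum>i=1..N g t. u i g t * (s * x g t + (a' + c' g + l' t))) =
      (\<Sum>g=1..G. \<Sum>t=1..T. \<Sum>i=1..N g t. s * (u i g t * ?e g t) +
        u i g t * ((s * ax + a') + (s * cx g + c' g) + (s * lx t + l' t)))"
      by (intro sum.cong refl, subst x) (auto simp: algebra_simps)
    also have "\<dots> = s * (\<Sum>g=1..G. \<Sum>t=1..T. \<Sum>i=1..N g t. u i g t * ?e g t) +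
      (\<Sum>g=1..G. \<Sum>t=1..T. \<Sum>i=1..N g t.
        u i g t * ((s * ax + a') + (s * cx g + c' g) + (s * lx t + l' t)))"
      by (simp only: sum.distrib sum_distrib_left)
    also have "\<dots> = 0"
      using ue fe[of "s * ax + a'" "\<lambda>g. s * cx g + c' g" "\<lambda>t. s * lx t + l' t"]
      by (simp add: u_def)
    finally show ?thesis .
  qed
  \<comment> \<open>The difference of the two fitted values, slope term included.\<close>
  define d where "d = (\<lambda>b' a' c' l' g t. (b0 - b') * x g t + ((a - a') + (c g - c' g) + (l t - l' t)))"
  have pyth: "fe_ssr G T N (\<lambda>i g t. y i g t - b' * x g t) a' c' l' =
      fe_ssr G T N (\<lambda>i g t. y i g t - b0 * x g t) a c l +
      (\<Sum>g=1..G. \<Sum>t=1..T. real (N g t) * (d b' a' c' l' g t)\<^sup>2)" for b' a' c' l'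
    by (rule fe_ssr_pythagoras)
      (use ux[of "b0 - b'" "a - a'" "\<lambda>g. c g - c' g" "\<lambda>t. l t - l' t"]
        in \<open>simp_all add: u_def d_def algebra_simps\<close>)
  have "fe_coef G T N y x = b0"
    unfolding fe_coef_def
  proof (rule the_equality)
    have "fe_ssr G T N (\<lambda>i g t. y i g t - b0 * x g t) a c l
        \<le> fe_ssr G T N (\<lambda>i g t. y i g t - b' * x g t) a' c' l'" for b' a' c' l'
      unfolding pyth[of b' a' c' l'] by (auto intro!: sum_nonneg)
    then show "\<exists>a c l. \<forall>b' a' c' l'. fe_ssr G T N (\<lambda>i g t. y i g t - b0 * x g t) a c l
        \<le> fe_ssr G T N (\<lambda>i g t. y i g t - b' * x g t) a' c' l'"
      by blast
  next
    fix b
    assume "\<exists>a c l. \<forall>b' a' c' l'. fe_ssr G T N (\<lambda>i g t. y i g t - b * x g t) a c l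
        \<le> fe_ssr G T N (\<lambda>i g t. y i g t - b' * x g t) a' c' l'"
    then obtain a' c' l' where min: "fe_ssr G T N (\<lambda>i g t. y i g t - b * x g t) a' c' l'
        \<le> fe_ssr G T N (\<lambda>i g t. y i g t - b0 * x g t) a c l"
      by blast
    have d0: "d b a' c' l' g t = 0" if "g \<in> {1..G}" "t \<in> {1..T}" for g t
      using min pyth[of b a' c' l'] by (intro cell_norm_eq_0D[OF N _ that]) simp
    show "b = b0"
    proof (rule ccontr)
      assume "b \<noteq> b0"
      have "x g t = (a - a') / (b - b0) + (c g - c' g) / (b - b0) + (l t - l' t) / (b - b0)"
        if "g \<in> {1..G}" "t \<in> {1..T}" for g t
      proof -
        have "(b - b0) * x g t = (a - a') + (c g - c' g) + (l t - l' t)"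
          using d0[OF that] by (simp add: d_def algebra_simps)
        then have "x g t = ((a - a') + (c g - c' g) + (l t - l' t)) / (b - b0)"
          using \<open>b \<noteq> b0\<close> by (simp add: eq_divide_eq mult.commute)
        then show ?thesis by (simp add: add_divide_distrib)
      qed
      then have "fe_collinear G T x"
        by (rule fe_collinearI[where a = "(a - a') / (b - b0)"
            and c = "\<lambda>g. (c g - c' g) / (b - b0)" and l = "\<lambda>t. (l t - l' t) / (b - b0)"])
      then show False
        using nc by contradiction
    qed
  qed
  then show ?thesis by (simp add: b0_def)
qed

text \<open>
  The collinear case has probability zero, but it is needed for the measurability of \<open>beta_fe_hat\<close>:
  \<open>M\<close> need not be complete.
\<close>

lemma fe_coef_collinear:
  assumes "fe_collinear G T x"
  shows "fe_coef G T N y x = (THE b. True)"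
proof -
  obtain ax cx lx
    where x: "\<And>g t. g \<in> {1..G} \<Longrightarrow> t \<in> {1..T} \<Longrightarrow> x g t = ax + cx g + lx t"
    using assms unfolding fe_collinear_def by blast
  \<comment> \<open>Under collinearity a change of slope can be undone by the fixed effects, so
    every \<open>b\<close> attains the same minimum.\<close>
  have absorb: "fe_ssr G T N (\<lambda>i g t. y i g t - b * x g t) a c l =
      fe_ssr G T N y (a + b * ax) (\<lambda>g. c g + b * cx g) (\<lambda>t. l t + b * lx t)" for b a c l
    unfolding fe_ssr_def by (intro sum.cong refl) (simp add: x algebra_simps)
  obtain a c l where orth: "\<And>a' c' l'. (\<Sum>g=1..G. \<Sum>t=1..T. \<Sum>i=1..N g t.
      (y i g t - (a + c g + l t)) * (a' + c' g + l' t)) = 0"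
    by (rule fe_projection_exists[where G=G and T=T and N=N and y=y]) blast
  have pyth: "fe_ssr G T N y a' c' l' = fe_ssr G T N y a c l +
      (\<Sum>g=1..G. \<Sum>t=1..T. real (N g t) * ((a - a') + (c g - c' g) + (l t - l' t))\<^sup>2)" for a' c' l'
    by (rule fe_ssr_pythagoras)
      (use orth[of "a - a'" "\<lambda>g. c g - c' g" "\<lambda>t. l t - l' t"] in \<open>simp_all add: algebra_simps\<close>)
  have min: "fe_ssr G T N y a c l \<le> fe_ssr G T N y a' c' l'" for a' c' l'
    unfolding pyth[of a' c' l'] by (auto intro!: sum_nonneg)
  have "\<exists>a c l. \<forall>b' a' c' l'. fe_ssr G T N (\<lambda>i g t. y i g t - b * x g t) a c l
        \<le> fe_ssr G T N (\<lambda>i g t. y i g t - b' * x g t) a' c' l'" for b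
  proof -
    have "fe_ssr G T N (\<lambda>i g t. y i g t - b * x g t)
          (a - b * ax) (\<lambda>g. c g - b * cx g) (\<lambda>t. l t - b * lx t)
        \<le> fe_ssr G T N (\<lambda>i g t. y i g t - b' * x g t) a' c' l'" for b' a' c' l'
      unfolding absorb by (simp add: min)
    then show ?thesis by blast
  qed
  then show ?thesis
    unfolding fe_coef_def by simp
qed

section \<open>The coefficient as a linear combination of cell means\<close>

text \<open>The factor with which the mean outcome of a cell enters \<open>fe_coef\<close>. The sums
  in the denominator rebind \<open>g\<close> and \<open>t\<close>, so it is the same for all
  cells.\<close>

definition fe_slope_weight ::
  "nat \<Rightarrow> nat \<Rightarrow> (nat \<Rightarrow> nat \<Rightarrow> nat) \<Rightarrow> (nat \<Rightarrow> nat \<Rightarrow> real) \<Rightarrow> nat \<Rightarrow> nat \<Rightarrow> real" where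
  "fe_slope_weight G T N x g t = real (N g t) * fe_residual G T N x g t /
     (\<Sum>g=1..G. \<Sum>t=1..T. real (N g t) * fe_residual G T N x g t * x g t)"

lemma fe_coef_eq_slope_weight:
  assumes N: "\<forall>g\<in>{1..G}. \<forall>t\<in>{1..T}. N g t > 0" and "\<not> fe_collinear G T x"
  shows "fe_coef G T N y x =
    (\<Sum>g=1..G. \<Sum>t=1..T. fe_slope_weight G T N x g t * ((\<Sum>i=1..N g t. y i g t) / real (N g t)))"
proof -
  let ?den = "\<Sum>g=1..G. \<Sum>t=1..T. real (N g t) * fe_residual G T N x g t * x g t"
  have "fe_coef G T N y x =
      (\<Sum>g=1..G. \<Sum>t=1..T. fe_residual G T N x g t * (\<Sum>i=1..N g t. y i g t) / ?den)"
    unfolding fe_coef_eq[OF assms] by (simp only: sum_divide_distrib)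
  also have "\<dots> =
      (\<Sum>g=1..G. \<Sum>t=1..T. fe_slope_weight G T N x g t * ((\<Sum>i=1..N g t. y i g t) / real (N g t)))"
    using N by (intro sum.cong refl) (auto simp: fe_slope_weight_def)
  finally show ?thesis .
qed

lemma fe_slope_weight_sum_periods:
  assumes "\<forall>g\<in>{1..G}. \<forall>t\<in>{1..T}. N g t > 0" "g \<in> {1..G}"
  shows "(\<Sum>t=1..T. fe_slope_weight G T N x g t) = 0"
  unfolding fe_slope_weight_def sum_divide_distrib[symmetric] fe_residual_sum_periods[OF assms]
  by simp

lemma fe_slope_weight_sum_groups:
  assumes "\<forall>g\<in>{1..G}. \<forall>t\<in>{1..T}. N g t > 0" "t \<in> {1..T}"
  shows "(\<Sum>g=1..G. fe_slope_weight G T N x g t) = 0"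
  unfolding fe_slope_weight_def sum_divide_distrib[symmetric] fe_residual_sum_groups[OF assms]
  by simp

text \<open>The weights sum to zero over the periods of each group and over the groups of each
  period, which annihilates terms depending on one index only.\<close>

lemma fe_slope_weight_eliminates_fe:
  assumes N: "\<forall>g\<in>{1..G}. \<forall>t\<in>{1..T}. N g t > 0"
  shows "(\<Sum>g=1..G. \<Sum>t=1..T. fe_slope_weight G T N x g t * (z g t - c g - l t)) =
    (\<Sum>g=1..G. \<Sum>t=1..T. fe_slope_weight G T N x g t * z g t)"
proof -
  let ?w = "fe_slope_weight G T N x"
  have "(\<Sum>g=1..G. \<Sum>t=1..T. ?w g t * c g) = 0"
    by (rule sum.neutral, rule ballI)
      (simp only: sum_distrib_right[symmetric] fe_slope_weight_sum_periods[OF N] mult_zero_left)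
  moreover have "(\<Sum>g=1..G. \<Sum>t=1..T. ?w g t * l t) = 0"
    by (subst sum.swap, rule sum.neutral, rule ballI)
      (simp only: sum_distrib_right[symmetric] fe_slope_weight_sum_groups[OF N] mult_zero_left)
  ultimately show ?thesis
    by (simp add: right_diff_distrib sum_subtractf)
qed

section \<open>Dependence on the values at the cells alone, and measurability\<close>

lemma fe_ssr_cong:
  assumes "\<And>g t i. g \<in> {1..G} \<Longrightarrow> t \<in> {1..T} \<Longrightarrow> i \<in> {1..N g t} \<Longrightarrow> y i g t = y' i g t"
  shows "fe_ssr G T N y = fe_ssr G T N y'"
  unfolding fe_ssr_def using assms by (intro ext sum.cong refl) simp

lemma fe_residual_cong:
  assumes x: "\<And>g t. g \<in> {1..G} \<Longrightarrow> t \<in> {1..T} \<Longrightarrow> x g t = x' g t"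
    and "g \<in> {1..G}" "t \<in> {1..T}"
  shows "fe_residual G T N x g t = fe_residual G T N x' g t"
proof -
  have "fe_ssr G T N (\<lambda>i. x) = fe_ssr G T N (\<lambda>i. x')"
    by (rule fe_ssr_cong) (simp add: x)
  then show ?thesis
    unfolding fe_residual_def using x assms(2,3) by simp
qed

lemma fe_slope_weight_cong:
  assumes x: "\<And>g t. g \<in> {1..G} \<Longrightarrow> t \<in> {1..T} \<Longrightarrow> x g t = x' g t"
    and gt: "g \<in> {1..G}" "t \<in> {1..T}"
  shows "fe_slope_weight G T N x g t = fe_slope_weight G T N x' g t"
proof -
  have "(\<Sum>g=1..G. \<Sum>t=1..T. real (N g t) * fe_residual G T N x g t * x g t) =
      (\<Sum>g=1..G. \<Sum>t=1..T. real (N g t) * fe_residual G T N x' g t * x' g t)"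
    by (intro sum.cong refl arg_cong2[where f = "(*)"] fe_residual_cong x) assumption+
  then show ?thesis
    using fe_residual_cong[of G T x x', OF x gt] by (simp add: fe_slope_weight_def)
qed

lemma fe_coef_cong:
  assumes x: "\<And>g t. g \<in> {1..G} \<Longrightarrow> t \<in> {1..T} \<Longrightarrow> x g t = x' g t"
    and y: "\<And>g t i. g \<in> {1..G} \<Longrightarrow> t \<in> {1..T} \<Longrightarrow> i \<in> {1..N g t} \<Longrightarrow> y i g t = y' i g t"
  shows "fe_coef G T N y x = fe_coef G T N y' x'"
proof -
  have "fe_ssr G T N (\<lambda>i g t. y i g t - b * x g t) = fe_ssr G T N (\<lambda>i g t. y' i g t - b * x' g t)" for b
    by (rule fe_ssr_cong) (simp add: x y)
  then show ?thesis
    unfolding fe_coef_def by simp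
qed

text \<open>For fixed \<open>x\<close> the coefficient is linear in the outcomes absent
  collinearity, and constant otherwise.\<close>

lemma fe_coef_measurable:
  assumes N: "\<forall>g\<in>{1..G}. \<forall>t\<in>{1..T}. N g t > 0"
    and y: "\<And>g t i. g \<in> {1..G} \<Longrightarrow> t \<in> {1..T} \<Longrightarrow> i \<in> {1..N g t} \<Longrightarrow>
      (\<lambda>\<omega>. y \<omega> i g t) \<in> borel_measurable M"
  shows "(\<lambda>\<omega>. fe_coef G T N (y \<omega>) x) \<in> borel_measurable M"
proof (cases "fe_collinear G T x")
  case True
  then show ?thesis by (simp add: fe_coef_collinear)
next
  case False
  show ?thesis
    unfolding fe_coef_eq_slope_weight[OF N False]
    by (intro borel_measurable_sum borel_measurable_times borel_measurable_divide
        borel_measurable_const y)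
qed

text \<open>Extension by 0 to the untreated cells turns a sum over the random set
  \<open>treated_cells\<close> into one over a fixed index set, which can be exchanged with the
  integral.\<close>

definition fe_treated_weight ::
  "nat \<Rightarrow> nat \<Rightarrow> (nat \<Rightarrow> nat \<Rightarrow> nat) \<Rightarrow> (nat \<Rightarrow> nat \<Rightarrow> nat \<Rightarrow> 'a \<Rightarrow> nat)
    \<Rightarrow> nat \<Rightarrow> nat \<Rightarrow> 'a \<Rightarrow> real" where
  "fe_treated_weight G T N D g t \<omega> =
     (if cell_treatment N D g t \<omega> = 1
      then real (N g t) / real (num_treated G T N D \<omega>) * fe_weight G T N D g t \<omega> else 0)"

lemma sum_treated_cells:
  fixes f :: "nat \<Rightarrow> nat \<Rightarrow> real"
  shows "(\<Sum>(g, t)\<in>treated_cells G T N D \<omega>. f g t) =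
    (\<Sum>g=1..G. \<Sum>t=1..T. if cell_treatment N D g t \<omega> = 1 then f g t else 0)"
proof -
  have "treated_cells G T N D \<omega> =
      {p \<in> {1..G} \<times> {1..T}. cell_treatment N D (fst p) (snd p) \<omega> = 1}"
    unfolding treated_cells_def by auto
  then show ?thesis
    by (simp add: sum.cartesian_product case_prod_beta sum.inter_filter)
qed

lemma sum_treated_cells_fe_weight:
  "(\<Sum>(g, t)\<in>treated_cells G T N D \<omega>.
      real (N g t) / real (num_treated G T N D \<omega>) * fe_weight G T N D g t \<omega> * f g t) =
   (\<Sum>g=1..G. \<Sum>t=1..T. fe_treated_weight G T N D g t \<omega> * f g t)"
  unfolding sum_treated_cells by (intro sum.cong refl) (simp add: fe_treated_weight_def)

lemma cell_treatment_cong: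
  assumes "\<And>i. i \<in> {1..N g t} \<Longrightarrow> D i g t \<omega> = D' i g t \<omega>'"
  shows "cell_treatment N D g t \<omega> = cell_treatment N D' g t \<omega>'"
  unfolding cell_treatment_def cell_mean_def using assms by simp

lemma fe_treated_weight_cong:
  assumes D: "\<And>g t i. g \<in> {1..G} \<Longrightarrow> t \<in> {1..T} \<Longrightarrow> i \<in> {1..N g t} \<Longrightarrow> D i g t \<omega> = D' i g t \<omega>'"
    and gt: "g \<in> {1..G}" "t \<in> {1..T}"
  shows "fe_treated_weight G T N D g t \<omega> = fe_treated_weight G T N D' g t \<omega>'"
proof -
  have x: "cell_treatment N D g t \<omega> = cell_treatment N D' g t \<omega>'"
    if "g \<in> {1..G}" "t \<in> {1..T}" for g t
    using that by (intro cell_treatment_cong D)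
  have e: "treatment_residual G T N D g t \<omega> = treatment_residual G T N D' g t \<omega>'"
    if "g \<in> {1..G}" "t \<in> {1..T}" for g t
    unfolding treatment_residual_def using that by (intro fe_residual_cong x)
  have n: "num_treated G T N D \<omega> = num_treated G T N D' \<omega>'"
    unfolding num_treated_def by (intro sum.cong refl D)
  have "fe_weight G T N D g t \<omega> = fe_weight G T N D' g t \<omega>'"
    unfolding fe_weight_def sum_treated_cells n e[OF gt]
    by (intro arg_cong[where f = "\<lambda>s. _ / s"] sum.cong refl) (simp add: x e)
  then show ?thesis
    using x[OF gt] n by (simp add: fe_treated_weight_def)
qed

text \<open>For a binary treatment, restricting a sum to treated cells amounts to multiplying by the
  treatment. The denominators then agree up to the number of treated observations, which cancels: it
  is nonzero because an identically zero treatment is collinear.\<close>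

lemma fe_treated_weight_eq:
  assumes N: "\<forall>g\<in>{1..G}. \<forall>t\<in>{1..T}. N g t > 0"
    and nc: "\<not> fe_collinear G T (\<lambda>g t. cell_treatment N D g t \<omega>)"
    and bin: "\<And>g t. g \<in> {1..G} \<Longrightarrow> t \<in> {1..T} \<Longrightarrow> cell_treatment N D g t \<omega> \<in> {0, 1}"
    and gt: "g \<in> {1..G}" "t \<in> {1..T}"
  shows "fe_treated_weight G T N D g t \<omega> =
    fe_slope_weight G T N (\<lambda>g t. cell_treatment N D g t \<omega>) g t * cell_treatment N D g t \<omega>"
proof -
  let ?x = "\<lambda>g t. cell_treatment N D g t \<omega>"
  let ?n = "real (num_treated G T N D \<omega>)"
  have n: "?n \<noteq> 0"
  proof
    assume "?n = 0"
    then have "num_treated G T N D \<omega> = 0" by simp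
    then have "D i g t \<omega> = 0" if "g \<in> {1..G}" "t \<in> {1..T}" "i \<in> {1..N g t}" for g t i
      using that by (auto simp: num_treated_def)
    then have "?x g t = 0" if "g \<in> {1..G}" "t \<in> {1..T}" for g t
      using that by (simp add: cell_treatment_def cell_mean_def)
    then have "fe_collinear G T ?x"
      by (intro fe_collinearI[where a = 0 and c = "\<lambda>_. 0" and l = "\<lambda>_. 0"]) simp
    then show False using nc by contradiction
  qed
  have "(\<Sum>(g', t')\<in>treated_cells G T N D \<omega>.
        real (N g' t') / ?n * treatment_residual G T N D g' t' \<omega>) =
      (\<Sum>g=1..G. \<Sum>t=1..T. real (N g t) * fe_residual G T N ?x g t * ?x g t) / ?n"
    unfolding sum_treated_cells sum_divide_distrib
    using bin by (intro sum.cong refl) (auto simp: treatment_residual_def)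
  then show ?thesis
    using n bin[OF gt]
    by (auto simp: fe_treated_weight_def fe_weight_def fe_slope_weight_def treatment_residual_def)
qed

text \<open>For binary \<open>D\<close> the outcome is \<open>Y(0) + D * (Y(1) - Y(0))\<close>;
  under the sharp design \<open>D\<close> is constant within the cell and leaves the mean.\<close>

lemma cell_mean_observed:
  assumes N: "N g t > 0"
    and sharp: "\<And>i. i \<in> {1..N g t} \<Longrightarrow> real (D i g t \<omega>) = cell_treatment N D g t \<omega>"
    and bin: "\<And>i. i \<in> {1..N g t} \<Longrightarrow> D i g t \<omega> \<in> {0, 1}"
  shows "cell_mean N (observed D Y) g t \<omega> =
      cell_potential N Y 0 g t \<omega> + cell_treatment N D g t \<omega> * cell_effect N Y g t \<omega>"
    and "cell_treatment N D g t \<omega> \<in> {0, 1}"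
proof -
  have 1: "1 \<in> {1..N g t}"
    using N by simp
  show bin': "cell_treatment N D g t \<omega> \<in> {0, 1}"
    using sharp[OF 1] bin[OF 1] by auto
  have "observed D Y i g t \<omega> =
      Y i g t 0 \<omega> + cell_treatment N D g t \<omega> * (Y i g t 1 \<omega> - Y i g t 0 \<omega>)"
    if "i \<in> {1..N g t}" for i
    using bin[OF that] by (auto simp: observed_def sharp[OF that, symmetric])
  then have "cell_mean N (observed D Y) g t \<omega> = (\<Sum>i=1..N g t.
      Y i g t 0 \<omega> + cell_treatment N D g t \<omega> * (Y i g t 1 \<omega> - Y i g t 0 \<omega>)) / real (N g t)"
    unfolding cell_mean_def by simp
  then show "cell_mean N (observed D Y) g t \<omega> =
      cell_potential N Y 0 g t \<omega> + cell_treatment N D g t \<omega> * cell_effect N Y g t \<omega>"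
    by (simp add: cell_potential_def cell_effect_def cell_mean_def sum.distrib
        sum_distrib_left[symmetric] add_divide_distrib)
qed

section \<open>Integrals against functions of the treatments\<close>

text \<open>Only the summand for \<open>v = c \<omega>\<close> survives. Integrals against functions
  of the treatments thereby reduce to integrals over finitely many treatment events.\<close>

lemma mult_finite_range_eq_sum:
  fixes f :: "'a \<Rightarrow> real" and h :: "'c \<Rightarrow> real"
  assumes "finite C" "c \<in> M \<rightarrow>\<^sub>M count_space C" "\<omega> \<in> space M"
  shows "h (c \<omega>) * f \<omega> = (\<Sum>v\<in>C. h v * (indicator (c -` {v} \<inter> space M) \<omega> * f \<omega>))"
proof -
  have "c \<omega> \<in> C"
    using measurable_space[OF assms(2,3)] by simp
  have "(\<Sum>v\<in>C. h v * (indicator (c -` {v} \<inter> space M) \<omega> * f \<omega>)) =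
      (\<Sum>v\<in>C. if v = c \<omega> then h v * f \<omega> else 0)"
    using assms(3) by (intro sum.cong) (auto simp: indicator_def)
  then show ?thesis
    using assms(1) \<open>c \<omega> \<in> C\<close> by simp
qed

lemma
  fixes f :: "'a \<Rightarrow> real" and h :: "'c \<Rightarrow> real"
  assumes C: "finite C" and c: "c \<in> M \<rightarrow>\<^sub>M count_space C" and f: "integrable M f"
  shows integrable_mult_finite_range: "integrable M (\<lambda>\<omega>. h (c \<omega>) * f \<omega>)"
    and integral_mult_finite_range: "(\<integral>\<omega>. h (c \<omega>) * f \<omega> \<partial>M) =
      (\<Sum>v\<in>C. h v * (\<integral>\<omega>. indicator (c -` {v} \<inter> space M) \<omega> * f \<omega> \<partial>M))"
proof -
  have "c -` {v} \<inter> space M \<in> sets M" if "v \<in> C" for v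
    using that by (intro measurable_sets[OF c]) simp
  then have int: "integrable M (\<lambda>\<omega>. indicator (c -` {v} \<inter> space M) \<omega> * f \<omega>)" if "v \<in> C" for v
    using integrable_mult_indicator[OF _ f] that by simp
  have eq: "h (c \<omega>) * f \<omega> = (\<Sum>v\<in>C. h v * (indicator (c -` {v} \<inter> space M) \<omega> * f \<omega>))"
    if "\<omega> \<in> space M" for \<omega>
    by (rule mult_finite_range_eq_sum[OF C c that])
  show "integrable M (\<lambda>\<omega>. h (c \<omega>) * f \<omega>)"
    using int by (subst Bochner_Integration.integrable_cong[OF refl eq]) auto
  show "(\<integral>\<omega>. h (c \<omega>) * f \<omega> \<partial>M) =
      (\<Sum>v\<in>C. h v * (\<integral>\<omega>. indicator (c -` {v} \<inter> space M) \<omega> * f \<omega> \<partial>M))"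
    using int by (subst Bochner_Integration.integral_cong[OF refl eq]) auto
qed

text \<open>A finite product of countable discrete spaces is discrete, so every function of the
  collected variables is measurable.\<close>

lemma measurable_restrict_count_space:
  assumes "finite J" "\<And>j. countable (S j)"
    and "\<And>j. j \<in> J \<Longrightarrow> X j \<in> M \<rightarrow>\<^sub>M count_space (S j)"
  shows "(\<lambda>\<omega>. \<lambda>j\<in>J. X j \<omega>) \<in> M \<rightarrow>\<^sub>M count_space (Pi\<^sub>E J S)"
proof -
  have "(\<lambda>\<omega>. \<lambda>j\<in>J. X j \<omega>) \<in> M \<rightarrow>\<^sub>M (\<Pi>\<^sub>M j\<in>J. count_space (S j))"
    using assms(3) by (rule measurable_restrict)
  then show ?thesis
    using assms(1,2) by (simp add: count_space_PiM_finite)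
qed

text \<open>On an event of \<open>F\<close>, \<open>f\<close> may be replaced by its conditional
  expectation, which is almost surely the constant \<open>expectation f\<close>.\<close>

lemma (in prob_space) integral_indicator_mult_centered_eq_0:
  fixes f :: "'a \<Rightarrow> real"
  assumes F: "subalgebra M F" and f: "integrable M f" and A: "A \<in> sets F"
    and ce: "AE \<omega> in M. real_cond_exp M F f \<omega> = expectation f"
  shows "expectation (\<lambda>\<omega>. indicator A \<omega> * (f \<omega> - expectation f)) = 0"
proof -
  interpret finite_measure_subalgebra M F
    by unfold_locales (rule F)
  have AM: "A \<in> sets M"
    using F A by (auto simp: subalgebra_def)
  have int: "integrable M (\<lambda>\<omega>. indicator A \<omega> * g \<omega>)" if "integrable M g" for g :: "'a \<Rightarrow> real"
    using integrable_mult_indicator[OF AM that] by simp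
  have "(\<integral>\<omega>. indicator A \<omega> * f \<omega> \<partial>M) = (\<integral>\<omega>. indicator A \<omega> * real_cond_exp M F f \<omega> \<partial>M)"
    using real_cond_exp_intA[OF f A] by (simp add: set_lebesgue_integral_def)
  also have "\<dots> = (\<integral>\<omega>. indicator A \<omega> * expectation f \<partial>M)"
    using ce by (intro integral_cong_AE) (use AM F in auto)
  finally show ?thesis
    using int[OF f] int[of "\<lambda>_. expectation f"]
    by (simp add: right_diff_distrib)
qed

text \<open>The integrand is a product of functions of single \<open>X j\<close>. Its expectation
  factorises by independence, and the factor of \<open>k\<close> vanishes by assumption.\<close>

lemma (in prob_space) indep_vars_integral_indicator_mult_eq_0:
  fixes u :: "'b \<Rightarrow> real"
  assumes indep: "indep_vars M' X I" and I: "finite I" "k \<in> I"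
    and B: "\<And>j. j \<in> I \<Longrightarrow> B j \<in> sets (M' j)"
    and u: "u \<in> borel_measurable (M' k)" "integrable M (\<lambda>\<omega>. u (X k \<omega>))"
    and zero: "expectation (\<lambda>\<omega>. indicator (B k) (X k \<omega>) * u (X k \<omega>)) = 0"
  shows "expectation (\<lambda>\<omega>. of_bool (\<forall>j\<in>I. X j \<omega> \<in> B j) * u (X k \<omega>)) = 0"
proof -
  \<comment> \<open>The factor \<open>u\<close> is attached to index \<open>k\<close> only; all
    other factors are plain indicators.\<close>
  define Z where "Z = (\<lambda>j p. indicator (B j) p * (if j = k then u p else 1 :: real))"
  have X: "X j \<in> M \<rightarrow>\<^sub>M M' j" if "j \<in> I" for j
    using indep that unfolding indep_vars_def2 by blast
  have Zm: "Z j \<in> borel_measurable (M' j)" if "j \<in> I" for j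
    using B[OF that] u(1) by (cases "j = k") (auto simp: Z_def)
  have ind: "indep_vars (\<lambda>_. borel) (\<lambda>j \<omega>. Z j (X j \<omega>)) I"
    using indep by (rule indep_vars_compose2) (rule Zm)
  have int: "integrable M (\<lambda>\<omega>. Z j (X j \<omega>))" if j: "j \<in> I" for j
  proof (rule Bochner_Integration.integrable_bound)
    show "integrable M (\<lambda>\<omega>. if j = k then u (X k \<omega>) else 1)"
      using u(2) by (cases "j = k") auto
    show "(\<lambda>\<omega>. Z j (X j \<omega>)) \<in> borel_measurable M"
      using measurable_compose[OF X[OF j] Zm[OF j]] .
    show "AE \<omega> in M. norm (Z j (X j \<omega>)) \<le> norm (if j = k then u (X k \<omega>) else 1)"
      by (auto simp: Z_def indicator_def)
  qed
  have "of_bool (\<forall>j\<in>I. X j \<omega> \<in> B j) * u (X k \<omega>) = (\<Prod>j\<in>I. Z j (X j \<omega>))" for \<omega>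
  proof -
    have "(\<Prod>j\<in>I. indicator (B j) (X j \<omega>) :: real) = of_bool (\<forall>j\<in>I. X j \<omega> \<in> B j)"
      using I(1) by (induction I rule: finite_induct) (auto simp: indicator_def)
    moreover have "(\<Prod>j\<in>I. if j = k then u (X j \<omega>) else 1) = u (X k \<omega>)"
      using I by simp
    ultimately show ?thesis
      by (simp add: Z_def prod.distrib)
  qed
  then have "expectation (\<lambda>\<omega>. of_bool (\<forall>j\<in>I. X j \<omega> \<in> B j) * u (X k \<omega>)) =
      (\<Prod>j\<in>I. expectation (\<lambda>\<omega>. Z j (X j \<omega>)))"
    using indep_vars_lebesgue_integral[OF I(1) ind int] by simp
  also have "\<dots> = 0"
    using I zero by (intro prod_zero bexI[of _ k]) (simp_all add: Z_def)
  finally show ?thesis .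
qed

section \<open>Cell means and the sigma-algebra of a group's treatments\<close>

lemma integrable_cell_mean:
  assumes "\<And>i. i \<in> {1..N g t} \<Longrightarrow> integrable M (X i g t)"
  shows "integrable M (cell_mean N X g t)"
  unfolding cell_mean_def
  by (intro integrable_divide_zero Bochner_Integration.integrable_sum) (use assms in auto)

lemma subalgebra_group_treatment_algebra:
  assumes "\<And>t. t \<in> {1..T} \<Longrightarrow> cell_treatment N D g t \<in> borel_measurable M"
  shows "subalgebra M (group_treatment_algebra M T N D g)"
proof -
  let ?V = "\<lambda>\<omega>. \<lambda>t\<in>{1..T}. cell_treatment N D g t \<omega>"
  have V: "?V \<in> M \<rightarrow>\<^sub>M (\<Pi>\<^sub>M t\<in>{1..T}. borel)"
    using assms by (intro measurable_restrict) auto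
  then have "?V \<in> space M \<rightarrow> space (\<Pi>\<^sub>M t\<in>{1..T}. borel)"
    by (auto dest: measurable_space)
  then show ?thesis
    unfolding subalgebra_def group_treatment_algebra_def
    using measurable_sets[OF V] by (auto simp: sets_vimage_algebra2)
qed

lemma group_treatment_event_in_algebra:
  "{\<omega> \<in> space M. \<forall>t\<in>{1..T}. cell_treatment N D g t \<omega> = v t}
    \<in> sets (group_treatment_algebra M T N D g)"
proof -
  let ?V = "\<lambda>\<omega>. \<lambda>t\<in>{1..T}. cell_treatment N D g t \<omega>"
  let ?P = "\<Pi>\<^sub>M t\<in>{1..T}. (borel :: real measure)"
  have "{p \<in> space ?P. \<forall>t\<in>{1..T}. p t = v t} \<in> sets ?P"
    by measurable
  then have "?V -` {p \<in> space ?P. \<forall>t\<in>{1..T}. p t = v t} \<inter> space M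
      \<in> sets (group_treatment_algebra M T N D g)"
    unfolding group_treatment_algebra_def by (rule in_vimage_algebra)
  also have "?V -` {p \<in> space ?P. \<forall>t\<in>{1..T}. p t = v t} \<inter> space M =
      {\<omega> \<in> space M. \<forall>t\<in>{1..T}. cell_treatment N D g t \<omega> = v t}"
    by (auto simp: space_PiM)
  finally show ?thesis .
qed

section \<open>Decomposition of the fixed effects coefficient\<close>

theorem theorem1:
  fixes M :: "'a measure"
    and G T :: nat
    and N :: "nat \<Rightarrow> nat \<Rightarrow> nat"
    and D :: "nat \<Rightarrow> nat \<Rightarrow> nat \<Rightarrow> 'a \<Rightarrow> nat"
    and Y :: "nat \<Rightarrow> nat \<Rightarrow> nat \<Rightarrow> nat \<Rightarrow> 'a \<Rightarrow> real"
  assumes "prob_space M"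
    and binary_treatment: "\<forall>g\<in>{1..G}. \<forall>t\<in>{1..T}. \<forall>i\<in>{1..N g t}.
      D i g t \<in> M \<rightarrow>\<^sub>M count_space {0, 1}"
    and finite_expectations: "\<forall>g\<in>{1..G}. \<forall>t\<in>{1..T}. \<forall>i\<in>{1..N g t}. \<forall>d\<in>{0, 1}.
      integrable M (Y i g t d)"
    and not_collinear: "AE \<omega> in M. \<not> fe_collinear G T (\<lambda>g t. cell_treatment N D g t \<omega>)"
    and balanced_panel: "\<forall>g\<in>{1..G}. \<forall>t\<in>{1..T}. N g t > 0"
    and sharp_design: "\<forall>g\<in>{1..G}. \<forall>t\<in>{1..T}. \<forall>i\<in>{1..N g t}.
      AE \<omega> in M. real (D i g t \<omega>) = cell_treatment N D g t \<omega>"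
    and independent_groups: "prob_space.indep_vars M
      (\<lambda>g. \<Pi>\<^sub>M t\<in>{1..T}. (borel :: (real \<times> real \<times> real) measure))
      (\<lambda>g \<omega>. \<lambda>t\<in>{1..T}.
         (cell_potential N Y 0 g t \<omega>, cell_potential N Y 1 g t \<omega>, cell_treatment N D g t \<omega>))
      {1..G}"
    and strong_exogeneity: "\<forall>g\<in>{1..G}. \<forall>t\<in>{2..T}. AE \<omega> in M.
      real_cond_exp M (group_treatment_algebra M T N D g)
        (\<lambda>\<omega>. cell_potential N Y 0 g t \<omega> - cell_potential N Y 0 g (t - 1) \<omega>) \<omega>
      = (\<integral>\<omega>. (cell_potential N Y 0 g t \<omega> - cell_potential N Y 0 g (t - 1) \<omega>) \<partial>M)"
    and common_trends: "\<forall>t\<in>{2..T}. \<forall>g\<in>{1..G}. \<forall>g'\<in>{1..G}.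
      (\<integral>\<omega>. (cell_potential N Y 0 g t \<omega> - cell_potential N Y 0 g (t - 1) \<omega>) \<partial>M)
      = (\<integral>\<omega>. (cell_potential N Y 0 g' t \<omega> - cell_potential N Y 0 g' (t - 1) \<omega>) \<partial>M)"
  shows "beta_fe M G T N D Y =
    (\<integral>\<omega>. (\<Sum>(g, t)\<in>treated_cells G T N D \<omega>.
        real (N g t) / real (num_treated G T N D \<omega>) * fe_weight G T N D g t \<omega>
          * cell_effect N Y g t \<omega>) \<partial>M)"
proof -
  interpret prob_space M by fact
  let ?x = "\<lambda>\<omega> g t. cell_treatment N D g t \<omega>"
  let ?y0 = "cell_potential N Y 0"
  note N = balanced_panel

  \<comment> \<open>\<open>c\<close> collects all individual treatments into one random variable
    with values in the finite set \<open>C\<close>. \<open>D'\<close> reads treatments back from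
    such a value, so statistics of \<open>D\<close> become functions of \<open>c\<close>.\<close>
  define J where "J = (SIGMA g:{1..G}. SIGMA t:{1..T}. {1..N g t})"
  define c where "c = (\<lambda>\<omega>. \<lambda>p\<in>J. D (snd (snd p)) (fst p) (fst (snd p)) \<omega>)"
  define C where "C = (J \<rightarrow>\<^sub>E {0, 1 :: nat})"
  define D' where "D' = (\<lambda>i g t (d :: nat \<times> nat \<times> nat \<Rightarrow> nat). d (g, t, i))"
  have "finite J"
    by (simp add: J_def)
  then have finC: "finite C"
    by (simp add: C_def finite_PiE)
  have c: "c \<in> M \<rightarrow>\<^sub>M count_space C"
    unfolding c_def C_def using \<open>finite J\<close> binary_treatment
    by (intro measurable_restrict_count_space) (auto simp: J_def)
  have D_c: "D i g t \<omega> = D' i g t (c \<omega>)"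
    if "g \<in> {1..G}" "t \<in> {1..T}" "i \<in> {1..N g t}" for i g t \<omega>
    using that by (simp add: D'_def c_def J_def)
  have x_c: "?x \<omega> g t = cell_treatment N D' g t (c \<omega>)"
    if "g \<in> {1..G}" "t \<in> {1..T}" for g t \<omega>
    using that by (intro cell_treatment_cong D_c)
  have x_meas: "cell_treatment N D g t \<in> borel_measurable M" if "g \<in> {1..G}" "t \<in> {1..T}" for g t
    using measurable_compose[OF c, of "cell_treatment N D' g t" borel] x_c[OF that]
    by (simp add: measurable_cong[of M "cell_treatment N D g t"])

  have Y_int: "integrable M (Y i g t d)"
    if "g \<in> {1..G}" "t \<in> {1..T}" "i \<in> {1..N g t}" "d \<in> {0, 1}" for i g t d
    using finite_expectations that by blast
  have y0_int: "integrable M (?y0 g t)" if "g \<in> {1..G}" "t \<in> {1..T}" for g t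
    unfolding cell_potential_def using that by (intro integrable_cell_mean Y_int) auto
  have effect_int: "integrable M (cell_effect N Y g t)" if "g \<in> {1..G}" "t \<in> {1..T}" for g t
    unfolding cell_effect_def
    using that by (intro integrable_cell_mean Bochner_Integration.integrable_diff Y_int) auto

  \<comment> \<open>Group 1 serves as reference, which common trends justify. The sum is empty for
    period 1, so \<open>u g 1\<close> is zero.\<close>
  define \<psi> where "\<psi> = (\<lambda>t. \<Sum>s=2..t. \<integral>\<omega>. (?y0 1 s \<omega> - ?y0 1 (s - 1) \<omega>) \<partial>M)"
  define u where "u = (\<lambda>g t \<omega>. ?y0 g t \<omega> - ?y0 g 1 \<omega> - \<psi> t)"
  define r where "r = (\<lambda>g t \<omega>. fe_slope_weight G T N (?x \<omega>) g t * u g t \<omega>)"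
  have u_int: "integrable M (u g t)" if "g \<in> {1..G}" "t \<in> {1..T}" for g t
    unfolding u_def using that by (intro Bochner_Integration.integrable_diff y0_int) auto

  \<comment> \<open>Telescoping from period 1, with common trends moving the means from group 1 to
    \<open>g\<close>, exhibits \<open>u\<close> as a sum of centred one-period changes, the
    quantities that strong exogeneity controls.\<close>
  have u_sum: "u g t \<omega> = (\<Sum>s=2..t. (?y0 g s \<omega> - ?y0 g (s - 1) \<omega>) -
      (\<integral>\<omega>. (?y0 g s \<omega> - ?y0 g (s - 1) \<omega>) \<partial>M))"
    if gt: "g \<in> {1..G}" "t \<in> {1..T}" for g t \<omega>
  proof -
    have "(\<integral>\<omega>. (?y0 1 s \<omega> - ?y0 1 (s - 1) \<omega>) \<partial>M) = (\<integral>\<omega>. (?y0 g s \<omega> - ?y0 g (s - 1) \<omega>) \<partial>M)"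
      if "s \<in> {2..t}" for s
      using common_trends[rule_format, of s 1 g] that gt by auto
    moreover have "(\<Sum>s=2..t. ?y0 g s \<omega> - ?y0 g (s - 1) \<omega>) = ?y0 g t \<omega> - ?y0 g 1 \<omega>"
      using sum_telescope''[of 1 t "\<lambda>s. ?y0 g s \<omega>"] gt(2) by (simp add: numeral_2_eq_2)
    ultimately show ?thesis
      by (simp add: u_def \<psi>_def sum_subtractf)
  qed

  have exog: "expectation (\<lambda>\<omega>. indicator A \<omega> * u g t \<omega>) = 0"
    if gt: "g \<in> {1..G}" "t \<in> {1..T}" and A: "A \<in> sets (group_treatment_algebra M T N D g)" for g t A
  proof -
    let ?F = "group_treatment_algebra M T N D g"
    have F: "subalgebra M ?F"
      using gt(1) by (intro subalgebra_group_treatment_algebra x_meas)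
    have AM: "A \<in> sets M"
      using F A by (auto simp: subalgebra_def)
    let ?dy = "\<lambda>s \<omega>. ?y0 g s \<omega> - ?y0 g (s - 1) \<omega>"
    have dy_int: "integrable M (?dy s)" if "s \<in> {2..t}" for s
      using that gt by (intro Bochner_Integration.integrable_diff y0_int) auto
    have int: "integrable M (\<lambda>\<omega>. indicator A \<omega> * (?dy s \<omega> - expectation (?dy s)))"
      if "s \<in> {2..t}" for s
      using integrable_mult_indicator[OF AM
          Bochner_Integration.integrable_diff[OF dy_int[OF that] integrable_const]]
      by simp
    have zero: "expectation (\<lambda>\<omega>. indicator A \<omega> * (?dy s \<omega> - expectation (?dy s))) = 0"
      if "s \<in> {2..t}" for s
      using strong_exogeneity that gt
      by (intro integral_indicator_mult_centered_eq_0[OF F dy_int[OF that] A]) auto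
    have "expectation (\<lambda>\<omega>. indicator A \<omega> * u g t \<omega>) =
        (\<Sum>s=2..t. expectation (\<lambda>\<omega>. indicator A \<omega> * (?dy s \<omega> - expectation (?dy s))))"
      unfolding u_sum[OF gt] sum_distrib_left
      by (rule Bochner_Integration.integral_sum) (rule int)
    also have "\<dots> = 0"
      using zero by simp
    finally show ?thesis .
  qed

  \<comment> \<open>\<open>c\<close> records individual treatments, but exogeneity and independence
    concern cell treatments only. The events to integrate over are therefore those of
    \<open>\<phi> (c \<omega>)\<close>.\<close>
  define \<phi> where "\<phi> = (\<lambda>d. \<lambda>g\<in>{1..G}. \<lambda>t\<in>{1..T}. cell_treatment N D' g t d)"
  have V: "(\<lambda>\<omega>. \<phi> (c \<omega>)) \<in> M \<rightarrow>\<^sub>M count_space (\<phi> ` C)"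
    by (rule measurable_compose[OF c]) simp
  \<comment> \<open>Elements of the image of \<open>\<phi>\<close> are \<open>undefined\<close> off
    the cells, so agreement on the cells is equality.\<close>
  have V_eq_iff: "\<phi> (c \<omega>) = v \<longleftrightarrow> (\<forall>g\<in>{1..G}. \<forall>t\<in>{1..T}. ?x \<omega> g t = v g t)"
    if "v \<in> \<phi> ` C" for v \<omega>
  proof -
    obtain d where "v = \<phi> d"
      using \<open>v \<in> \<phi> ` C\<close> by blast
    then show ?thesis
      by (auto simp: \<phi>_def fun_eq_iff restrict_def x_c)
  qed
  have r_V: "r g t \<omega> = fe_slope_weight G T N (\<phi> (c \<omega>)) g t * u g t \<omega>"
    if "g \<in> {1..G}" "t \<in> {1..T}" for g t \<omega>
    unfolding r_def using that
    by (intro arg_cong2[where f = "(*)"] refl fe_slope_weight_cong) (auto simp: \<phi>_def x_c)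
  have r_int: "integrable M (r g t)" if "g \<in> {1..G}" "t \<in> {1..T}" for g t
    unfolding r_V[OF that, abs_def]
    by (rule integrable_mult_finite_range[OF _ V u_int[OF that]]) (simp add: finC)

  have r_zero: "expectation (r g t) = 0" if gt: "g \<in> {1..G}" "t \<in> {1..T}" for g t
  proof -
    let ?X = "\<lambda>g \<omega>. \<lambda>t\<in>{1..T}. (?y0 g t \<omega>, cell_potential N Y 1 g t \<omega>, ?x \<omega> g t)"
    let ?P = "\<Pi>\<^sub>M t\<in>{1..T}. (borel :: (real \<times> real \<times> real) measure)"
    have [measurable]: "fst \<in> (borel :: (real \<times> real \<times> real) measure) \<rightarrow>\<^sub>M borel"
      "(\<lambda>p. snd (snd p)) \<in> (borel :: (real \<times> real \<times> real) measure) \<rightarrow>\<^sub>M borel"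
      by (intro borel_measurable_continuous_onI continuous_intros)+
    have "1 \<in> {1..T}"
      using gt by auto
    \<comment> \<open>\<open>u g t\<close> as a function of the vector of group \<open>g\<close>,
      the form in which independence applies.\<close>
    define w where "w = (\<lambda>p :: nat \<Rightarrow> real \<times> real \<times> real. fst (p t) - fst (p 1) - \<psi> t)"
    have w: "w \<in> borel_measurable ?P"
      unfolding w_def using gt(2) \<open>1 \<in> {1..T}\<close> by measurable
    have wX: "w (?X g \<omega>) = u g t \<omega>" for \<omega>
      using gt(2) \<open>1 \<in> {1..T}\<close> by (simp add: w_def u_def)
    have "expectation (\<lambda>\<omega>. indicator ((\<lambda>\<omega>. \<phi> (c \<omega>)) -` {v} \<inter> space M) \<omega> * u g t \<omega>) = 0"
      if v: "v \<in> \<phi> ` C" for v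
    proof -
      \<comment> \<open>The event that group \<open>j\<close> has the treatment path
        \<open>v j\<close>; their intersection over all groups fixes the value of
        \<open>\<phi> (c \<omega>)\<close>.\<close>
      define B where "B = (\<lambda>j. {p \<in> space ?P. \<forall>s\<in>{1..T}. snd (snd (p s)) = v j s})"
      have B: "B j \<in> sets ?P" for j
        unfolding B_def by measurable
      have X_B: "?X j \<omega> \<in> B j \<longleftrightarrow> (\<forall>s\<in>{1..T}. ?x \<omega> j s = v j s)" for j \<omega>
        by (auto simp: B_def space_PiM)
      have "expectation (\<lambda>\<omega>. indicator (B g) (?X g \<omega>) * w (?X g \<omega>)) =
          expectation (\<lambda>\<omega>. indicator {\<omega> \<in> space M. \<forall>s\<in>{1..T}. ?x \<omega> g s = v g s} \<omega> * u g t \<omega>)"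
        unfolding wX indicator_def X_B
        by (intro Bochner_Integration.integral_cong refl) simp
      also have "\<dots> = 0"
        by (intro exog[OF gt] group_treatment_event_in_algebra)
      finally have "expectation (\<lambda>\<omega>. of_bool (\<forall>j\<in>{1..G}. ?X j \<omega> \<in> B j) * w (?X g \<omega>)) = 0"
        by (intro indep_vars_integral_indicator_mult_eq_0[OF independent_groups _ gt(1) B w])
          (simp_all only: wX u_int[OF gt] finite_atLeastAtMost)
      also have "expectation (\<lambda>\<omega>. of_bool (\<forall>j\<in>{1..G}. ?X j \<omega> \<in> B j) * w (?X g \<omega>)) =
          expectation (\<lambda>\<omega>. indicator ((\<lambda>\<omega>. \<phi> (c \<omega>)) -` {v} \<inter> space M) \<omega> * u g t \<omega>)"
        unfolding wX X_B
        by (intro Bochner_Integration.integral_cong refl arg_cong2[where f = "(*)"])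
          (simp add: indicator_def V_eq_iff[OF v])
      finally show ?thesis .
    qed
    then show ?thesis
      unfolding r_V[OF gt, abs_def]
      by (subst integral_mult_finite_range[OF _ V u_int[OF gt]]) (simp_all add: finC)
  qed

  have AE_eq: "AE \<omega> in M. beta_fe_hat G T N D Y \<omega> =
      (\<Sum>g=1..G. \<Sum>t=1..T. fe_treated_weight G T N D g t \<omega> * cell_effect N Y g t \<omega>) +
      (\<Sum>g=1..G. \<Sum>t=1..T. r g t \<omega>)"
  proof -
    have sharp: "AE \<omega> in M. \<forall>g\<in>{1..G}. \<forall>t\<in>{1..T}. \<forall>i\<in>{1..N g t}. real (D i g t \<omega>) = ?x \<omega> g t"
      using sharp_design by (simp add: AE_ball_countable countable_finite)
    show ?thesis
      using AE_space not_collinear sharp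
    proof eventually_elim
      case (elim \<omega>)
      note nc = elim(2) and sharp = elim(3)
      let ?w = "fe_slope_weight G T N (?x \<omega>)"
      have bin: "D i g t \<omega> \<in> {0, 1}" if "g \<in> {1..G}" "t \<in> {1..T}" "i \<in> {1..N g t}" for i g t
        using binary_treatment[rule_format, OF that, THEN measurable_space, OF elim(1)] by simp
      have x01: "?x \<omega> g t \<in> {0, 1}" if "g \<in> {1..G}" "t \<in> {1..T}" for g t
        using that N sharp bin by (intro cell_mean_observed(2)) auto
      have "beta_fe_hat G T N D Y \<omega> =
          (\<Sum>g=1..G. \<Sum>t=1..T. ?w g t * cell_mean N (observed D Y) g t \<omega>)"
        unfolding beta_fe_hat_def fe_coef_eq_slope_weight[OF N nc] cell_mean_def ..
      also have "\<dots> = (\<Sum>g=1..G. \<Sum>t=1..T.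
          fe_treated_weight G T N D g t \<omega> * cell_effect N Y g t \<omega> + ?w g t * ?y0 g t \<omega>)"
      proof (intro sum.cong refl)
        fix g t assume gt: "g \<in> {1..G}" "t \<in> {1..T}"
        have "cell_mean N (observed D Y) g t \<omega> = ?y0 g t \<omega> + ?x \<omega> g t * cell_effect N Y g t \<omega>"
          using gt N sharp bin by (intro cell_mean_observed(1)) auto
        then show "?w g t * cell_mean N (observed D Y) g t \<omega> =
            fe_treated_weight G T N D g t \<omega> * cell_effect N Y g t \<omega> + ?w g t * ?y0 g t \<omega>"
          using fe_treated_weight_eq[OF N nc x01 gt] by (simp add: algebra_simps)
      qed
      also have "(\<Sum>g=1..G. \<Sum>t=1..T.
            fe_treated_weight G T N D g t \<omega> * cell_effect N Y g t \<omega> + ?w g t * ?y0 g t \<omega>) =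
          (\<Sum>g=1..G. \<Sum>t=1..T. fe_treated_weight G T N D g t \<omega> * cell_effect N Y g t \<omega>) +
          (\<Sum>g=1..G. \<Sum>t=1..T. ?w g t * ?y0 g t \<omega>)"
        by (simp only: sum.distrib)
      also have "(\<Sum>g=1..G. \<Sum>t=1..T. ?w g t * ?y0 g t \<omega>) = (\<Sum>g=1..G. \<Sum>t=1..T. r g t \<omega>)"
        unfolding r_def u_def by (rule fe_slope_weight_eliminates_fe[OF N, symmetric])
      finally show ?case .
    qed
  qed

  have hat_meas: "beta_fe_hat G T N D Y \<in> borel_measurable M"
  proof -
    \<comment> \<open>The treatments are frozen at \<open>d\<close>, leaving a measurable function
      of the potential outcomes; composing with \<open>c\<close> pastes the finitely many cases
      together.\<close>
    let ?f = "\<lambda>d \<omega>. fe_coef G T N (\<lambda>i g t. Y i g t (d (g, t, i)) \<omega>) (\<lambda>g t. cell_treatment N D' g t d)"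
    have "?f d \<in> borel_measurable M" if "d \<in> C" for d
      using that by (intro fe_coef_measurable[OF N] borel_measurable_integrable Y_int)
        (auto simp: C_def J_def)
    then have "(\<lambda>\<omega>. ?f (c \<omega>) \<omega>) \<in> borel_measurable M"
      using measurable_compose_countable'[where f = ?f and I = C and g = c, OF _ c countable_finite[OF finC]]
      by blast
    also have "(\<lambda>\<omega>. ?f (c \<omega>) \<omega>) = beta_fe_hat G T N D Y"
      unfolding beta_fe_hat_def
      by (intro ext fe_coef_cong) (auto simp: x_c observed_def D_c D'_def)
    finally show ?thesis .
  qed

  have treated_int: "integrable M (\<lambda>\<omega>. fe_treated_weight G T N D g t \<omega> * cell_effect N Y g t \<omega>)"
    if gt: "g \<in> {1..G}" "t \<in> {1..T}" for g t
  proof -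
    \<comment> \<open>Here \<open>c\<close> is used rather than \<open>\<phi> (c \<omega>)\<close>,
      because \<open>num_treated\<close> sums individual treatments.\<close>
    have "fe_treated_weight G T N D g t \<omega> = fe_treated_weight G T N D' g t (c \<omega>)" for \<omega>
      using gt by (intro fe_treated_weight_cong D_c)
    then show ?thesis
      using integrable_mult_finite_range[OF finC c effect_int[OF gt]] by simp
  qed

  let ?R = "\<lambda>\<omega>. \<Sum>g=1..G. \<Sum>t=1..T. fe_treated_weight G T N D g t \<omega> * cell_effect N Y g t \<omega>"
  let ?S = "\<lambda>\<omega>. \<Sum>g=1..G. \<Sum>t=1..T. r g t \<omega>"
  have R_int: "integrable M ?R" and S_int: "integrable M ?S"
    by (intro Bochner_Integration.integrable_sum treated_int r_int; assumption)+
  have "expectation ?S = (\<Sum>g=1..G. expectation (\<lambda>\<omega>. \<Sum>t=1..T. r g t \<omega>))"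
    by (intro Bochner_Integration.integral_sum Bochner_Integration.integrable_sum r_int)
  also have "\<dots> = (\<Sum>g=1..G. \<Sum>t=1..T. expectation (r g t))"
    by (intro sum.cong refl Bochner_Integration.integral_sum r_int)
  also have "\<dots> = 0"
    by (simp add: r_zero)
  finally have "expectation ?S = 0" .
  moreover have "beta_fe M G T N D Y = expectation (\<lambda>\<omega>. ?R \<omega> + ?S \<omega>)"
    unfolding beta_fe_def using R_int S_int
    by (intro integral_cong_AE hat_meas AE_eq) auto
  ultimately have "beta_fe M G T N D Y = expectation ?R"
    using R_int S_int by simp
  then show ?thesis
    unfolding sum_treated_cells_fe_weight .
qed

end
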